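(* Let $k$ be a field of characteristic different from $2$ containing a primitive fourth root of unity $i$, and let $H(2)_{\pm}=(H(2),R_{\pm})$ be the two-dimensional quasi-Hopf algebra $H(2)$ with $R$-matrix $R_\pm=1-(1\pm i)p_-\otimes p_-$. Then $bos(H(2)_{+})=bos(H(2)_{-})=k[C_2\times C_2]$ as bialgebras, viewed as a quasi-Hopf algebra via the non-trivial reassociator $\Phi_x:=1-2p^x_-\otimes p^x_-\otimes p^x_-$, where $x$ is one of the generators of $C_2\times C_2$ and $p^x_-:=\frac12(1-x)$. The antipode is the identity map and the distinguished elements $\alpha$ and $\beta$ are $\alpha=x$ and $\beta=1$, respectively. In particular, $bos(H(2)_{+})=bos(H(2)_{-})$ is an involutory quasi-Hopf algebra.
   Context: All algebras and linear spaces are over the field $k$; $\otimes=\otimes_k$. A quasi-bialgebra is a tuple $(H,\Delta,\varepsilon,\Phi)$ where $H$ is an associative unital algebra, $\Phi\in H\otimes H\otimes H$ (the reassociator) is invertible, and $\Delta:H\to H\otimes H$, $\varepsilon:H\to k$ are algebra homomorphisms such that, for all $h\in H$: $(\mathrm{id}\otimes\Delta)(\Delta(h))=\Phi(\Delta\otimes \mathrm{id})(\Delta(h))\Phi^{-1}$; $(\mathrm{id}\otimes\varepsilon)(\Delta(h))=h=(\varepsilon\otimes \mathrm{id})(\Delta(h))$; $(1\otimes\Phi)(\mathrm{id}\otimes\Delta\otimes \mathrm{id})(\Phi)(\Phi\otimes 1)=(\mathrm{id}\otimes \mathrm{id}\otimes\Delta)(\Phi)(\Delta\otimes \mathrm{id}\otimes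 \mathrm{id})(\Phi)$; $(\mathrm{id}\otimes\varepsilon\otimes \mathrm{id})(\Phi)=1\otimes 1$. Write $\Delta(h)=h_1\otimes h_2$, $\Phi=X^1\otimes X^2\otimes X^3=Y^1\otimes Y^2\otimes Y^3$, $\Phi^{-1}=x^1\otimes x^2\otimes x^3=y^1\otimes y^2\otimes y^3$ (summation understood; superscripts label tensor components; different letters denote different copies; $X^3_1\otimes X^3_2=\Delta(X^3)$ etc.). $H$ is a quasi-Hopf algebra if moreover there are an algebra anti-morphism $S:H\to H$ and $\alpha,\beta\in H$ with $S(h_1)\alpha h_2=\varepsilon(h)\alpha$, $h_1\beta S(h_2)=\varepsilon(h)\beta$, $X^1\beta S(X^2)\alpha X^3=1$, $S(x^1)\alpha x^2\beta S(x^3)=1$. It is involutory if $S^2(h)=S(\beta)\alpha h\beta S(\alpha)$ for all $h$. $H(2)$ (char $k\ne2$): the bialgebra $k[C_2]$, $C_2=\langle g\rangle$ of order two, with reassociator $\Phi=1-2p_-\otimes p_-\otimes p_-$, $p_\pm=\frac12(1\pm g)$, antipode $S=\mathrm{id}$, $\alpha=g$, $\beta=1$. The elements $R_\pm$ above are quasi-triangular structures on $H(2)$. Twist and related elements: $A^1\otimes A^2\otimes A^3\otimes A^4=(\Phi\otimes1)(\Delta\otimes\mathrm{id}\otimes\mathrm{id})(\Phi^{-1})$, $\gamma=S(A^2)\alpha A^3\otimes S(A^1)\alpha A^4$, $f=(S\otimes S)(\Delta^{\rm cop}(x^1))\gamma\Delta(x^2\beta S(x^3))$ with $\Delta^{\rm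 cop}(h)=h_2\otimes h_1$; $f^{-1}=G^1\otimes G^2$; $p_R=p^1\otimes p^2=x^1\otimes x^2\beta S(x^3)$; $q_R=q^1\otimes q^2=X^1\otimes S^{-1}(\alpha X^3)X^2$. Bosonisation: for a quasi-triangular quasi-Hopf algebra $(H,R)$, $R=R^1\otimes R^2$, let $H_0=H$ as a space, with product $h\circ h'=X^1hS(x^1X^2)\alpha x^2X^3_1h'S(x^3X^3_2)$ and left $H$-action $h\triangleright h'=h_1h'S(h_2)$. Define $\underline\Delta(b)=b_{\underline1}\otimes b_{\underline2}=x^1X^1b_1G^1S(x^2R^2y^3X^3_2)\otimes x^3R^1\triangleright\big(y^1X^2b_2G^2S(y^2X^3_1)\big)$ and $S_{H_0}(b)=X^1R^2p^2S\big(q^1(X^2R^1p^1\triangleright b)S(q^2)X^3\big)$. Then $bos(H_0)$, also denoted $bos(H)$ for $(H,R)$, is the space $H_0\otimes H$ with elements $b\times h$ and the quasi-Hopf structure: product $(b\times h)(b'\times h')=(x^1\triangleright b)\circ(x^2h_1\triangleright b')\times x^3h_2h'$; unit $\beta\times1$; coproduct $\Delta(b\times h)=y^1X^1\triangleright b_{\underline1}\times y^2Y^1R^2x^2X^3_1h_1\otimes y^3_1Y^2R^1x^1X^2\triangleright b_{\underline2}\times y^3_2Y^3x^3X^3_2h_2$; counit $\varepsilon(b\times h)=\varepsilon(b)\varepsilon(h)$; reassociator $\beta\times X^1\otimes\beta\times X^2\otimes\beta\times X^3$; antipode $s(b\times h)=(\beta\times S(X^1x^1_1R^2h)\alpha)(X^2x^1_2R^1\triangleright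 S_{H_0}(b)\times X^3x^2\beta S(x^3))$; distinguished elements $\beta\times\alpha$ and $\beta\times\beta$. *)

theory Defs
  imports
    Complex_Main
    "HOL-Library.Poly_Mapping"
    "HOL-Library.Product_Plus"
    "HOL-Library.Z2"
begin

section \<open>Linear spaces with a basis and their tensor products\<close>

text \<open>
  A linear space over the field \<open>'k\<close> is written in coordinates with respect to a basis
  indexed by \<open>'b\<close>, that is, as \<open>'b \<Rightarrow>\<^sub>0 'k\<close>. Its tensor product with
  \<open>'c \<Rightarrow>\<^sub>0 'k\<close> is \<open>'b \<times> 'c \<Rightarrow>\<^sub>0 'k\<close>; see \<open>sw2_tens\<close> and \<open>tens_universal\<close> below for the
  universal property. Iterated tensor products are nested to the right.
\<close>

definition smul :: "'k::field \<Rightarrow> ('b \<Rightarrow>\<^sub>0 'k) \<Rightarrow> ('b \<Rightarrow>\<^sub>0 'k)"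
  where "smul c v = Poly_Mapping.map ((*) c) v"

abbreviation basis_vec :: "'b \<Rightarrow> ('b \<Rightarrow>\<^sub>0 'k::field)"
  where "basis_vec b \<equiv> Poly_Mapping.single b 1"

definition lin_ext :: "('b \<Rightarrow> ('c \<Rightarrow>\<^sub>0 'k::field)) \<Rightarrow> ('b \<Rightarrow>\<^sub>0 'k) \<Rightarrow> ('c \<Rightarrow>\<^sub>0 'k)"
  where "lin_ext f v = (\<Sum>b\<in>Poly_Mapping.keys v. smul (Poly_Mapping.lookup v b) (f b))"

definition lin_form :: "('b \<Rightarrow> 'k::field) \<Rightarrow> ('b \<Rightarrow>\<^sub>0 'k) \<Rightarrow> 'k"
  where "lin_form f v = (\<Sum>b\<in>Poly_Mapping.keys v. Poly_Mapping.lookup v b * f b)"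

definition tens :: "('b \<Rightarrow>\<^sub>0 'k::field) \<Rightarrow> ('c \<Rightarrow>\<^sub>0 'k) \<Rightarrow> ('b \<times> 'c \<Rightarrow>\<^sub>0 'k)"  (infixr \<open>\<otimes>\<close> 70)
  where "v \<otimes> w = lin_ext (\<lambda>b. lin_ext (\<lambda>c. basis_vec (b, c)) w) v"

text \<open>
  Sweedler-type notation: for a multilinear expression \<open>F\<close>, \<open>sw2 t (\<lambda>a b. F a b)\<close> is the value
  of \<open>F t\<^sup>1 t\<^sup>2\<close> where \<open>t = t\<^sup>1 \<otimes> t\<^sup>2\<close> with summation understood; likewise for three and four legs.
\<close>

definition sw2 ::
  "('a \<times> 'b \<Rightarrow>\<^sub>0 'k::field) \<Rightarrow> (('a \<Rightarrow>\<^sub>0 'k) \<Rightarrow> ('b \<Rightarrow>\<^sub>0 'k) \<Rightarrow> ('z \<Rightarrow>\<^sub>0 'k)) \<Rightarrow> ('z \<Rightarrow>\<^sub>0 'k)"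
  where "sw2 t F = lin_ext (\<lambda>(a, b). F (basis_vec a) (basis_vec b)) t"

definition sw3 ::
  "('a \<times> 'b \<times> 'c \<Rightarrow>\<^sub>0 'k::field) \<Rightarrow>
    (('a \<Rightarrow>\<^sub>0 'k) \<Rightarrow> ('b \<Rightarrow>\<^sub>0 'k) \<Rightarrow> ('c \<Rightarrow>\<^sub>0 'k) \<Rightarrow> ('z \<Rightarrow>\<^sub>0 'k)) \<Rightarrow> ('z \<Rightarrow>\<^sub>0 'k)"
  where "sw3 t F = lin_ext (\<lambda>(a, b, c). F (basis_vec a) (basis_vec b) (basis_vec c)) t"

definition sw4 ::
  "('a \<times> 'b \<times> 'c \<times> 'd \<Rightarrow>\<^sub>0 'k::field) \<Rightarrow>
    (('a \<Rightarrow>\<^sub>0 'k) \<Rightarrow> ('b \<Rightarrow>\<^sub>0 'k) \<Rightarrow> ('c \<Rightarrow>\<^sub>0 'k) \<Rightarrow> ('d \<Rightarrow>\<^sub>0 'k) \<Rightarrow> ('z \<Rightarrow>\<^sub>0 'k)) \<Rightarrow> ('z \<Rightarrow>\<^sub>0 'k)"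
  where "sw4 t F =
    lin_ext (\<lambda>(a, b, c, d). F (basis_vec a) (basis_vec b) (basis_vec c) (basis_vec d)) t"

abbreviation k_linear :: "(('b \<Rightarrow>\<^sub>0 'k::field) \<Rightarrow> ('c \<Rightarrow>\<^sub>0 'k)) \<Rightarrow> bool"
  where "k_linear \<equiv> Vector_Spaces.linear smul smul"

abbreviation k_linear_form :: "(('b \<Rightarrow>\<^sub>0 'k::field) \<Rightarrow> 'k) \<Rightarrow> bool"
  where "k_linear_form \<equiv> Vector_Spaces.linear smul (*)"

definition k_bilinear ::
  "(('b \<Rightarrow>\<^sub>0 'k::field) \<Rightarrow> ('c \<Rightarrow>\<^sub>0 'k) \<Rightarrow> ('d \<Rightarrow>\<^sub>0 'k)) \<Rightarrow> bool"
  where "k_bilinear F \<longleftrightarrow> (\<forall>a. k_linear (F a)) \<and> (\<forall>b. k_linear (\<lambda>a. F a b))"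

lemma lookup_smul [simp]: "Poly_Mapping.lookup (smul c v) b = c * Poly_Mapping.lookup v b"
  by (simp add: smul_def map.rep_eq when_def)

lemma vector_space_smul: "vector_space (smul :: 'k::field \<Rightarrow> _ \<Rightarrow> ('b \<Rightarrow>\<^sub>0 'k))"
  by unfold_locales (auto intro!: poly_mapping_eqI simp: lookup_add algebra_simps)

lemma lin_ext_superset:
  assumes "finite A" "Poly_Mapping.keys v \<subseteq> A"
  shows "lin_ext f v = (\<Sum>b\<in>A. smul (Poly_Mapping.lookup v b) (f b))"
  unfolding lin_ext_def using assms
  by (intro sum.mono_neutral_left)
     (auto simp: in_keys_iff intro!: poly_mapping_eqI)

lemma k_linear_lin_ext:
  fixes f :: "'b \<Rightarrow> ('c \<Rightarrow>\<^sub>0 'k::field)"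
  shows "k_linear (lin_ext f)"
proof -
  interpret vector_space "smul :: 'k \<Rightarrow> ('c \<Rightarrow>\<^sub>0 'k) \<Rightarrow> _" by (rule vector_space_smul)
  have "lin_ext f (u + v) = lin_ext f u + lin_ext f v" for u v
  proof -
    let ?A = "Poly_Mapping.keys u \<union> Poly_Mapping.keys v"
    have "Poly_Mapping.keys (u + v) \<subseteq> ?A" by (rule keys_add)
    then show ?thesis
      by (simp add: lin_ext_superset[of ?A] lookup_add scale_left_distrib sum.distrib)
  qed
  moreover have "lin_ext f (smul c v) = smul c (lin_ext f v)" for c v
  proof -
    have "Poly_Mapping.keys (smul c v) \<subseteq> Poly_Mapping.keys v" by (auto simp: in_keys_iff)
    then show ?thesis
      by (simp add: lin_ext_superset[of "Poly_Mapping.keys v"] scale_sum_right)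
  qed
  ultimately show ?thesis
    using vector_space_smul vector_space_axioms
    by (intro Vector_Spaces.linear.intro module_hom.intro module_hom_axioms.intro)
       (auto simp: vector_space_def module_def)
qed

lemma lin_ext_basis_vec [simp]: "lin_ext f (basis_vec b) = f b"
  by (intro poly_mapping_eqI) (simp add: lin_ext_def lookup_single)

lemma k_linear_eq_lin_ext:
  assumes "k_linear L"
  shows "L v = lin_ext (\<lambda>b. L (basis_vec b)) v"
proof -
  interpret Vector_Spaces.linear smul smul L by (rule assms)
  have "v = (\<Sum>b\<in>Poly_Mapping.keys v. smul (Poly_Mapping.lookup v b) (basis_vec b))"
    by (intro poly_mapping_eqI)
       (auto simp: lookup_sum lookup_single when_def in_keys_iff if_distrib cong: if_cong)
  then have "L v = L (\<Sum>b\<in>Poly_Mapping.keys v. smul (Poly_Mapping.lookup v b) (basis_vec b))"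
    by (rule arg_cong)
  also have "\<dots> = lin_ext (\<lambda>b. L (basis_vec b)) v"
    by (simp add: sum scale lin_ext_def)
  finally show ?thesis .
qed

lemma k_linear_compose: "k_linear L \<Longrightarrow> k_linear M \<Longrightarrow> k_linear (\<lambda>v. M (L v))"
  using Vector_Spaces.linear_compose[of smul smul L smul M] by (simp add: comp_def)

lemma sw2_lin_ext: "sw2 (lin_ext h u) F = lin_ext (\<lambda>b. sw2 (h b) F) u"
proof -
  have "k_linear (\<lambda>t. sw2 t F)" by (simp add: sw2_def k_linear_lin_ext)
  from k_linear_eq_lin_ext[OF k_linear_compose[OF k_linear_lin_ext[of h] this], of u]
  show ?thesis by simp
qed

lemma basis_vec_tens: "basis_vec b \<otimes> basis_vec c = basis_vec (b, c)"
  by (simp add: tens_def)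

lemma sw2_basis_vec: "sw2 (basis_vec (b, c)) F = F (basis_vec b) (basis_vec c)"
  by (simp add: sw2_def)

lemma sw2_tens:
  assumes "k_bilinear F"
  shows "sw2 (v \<otimes> w) F = F v w"
proof -
  have right: "F (basis_vec b) w = lin_ext (\<lambda>c. F (basis_vec b) (basis_vec c)) w" for b
    using assms by (intro k_linear_eq_lin_ext) (simp add: k_bilinear_def)
  have left: "F v w = lin_ext (\<lambda>b. F (basis_vec b) w) v"
    using assms by (intro k_linear_eq_lin_ext[of "\<lambda>a. F a w"]) (simp add: k_bilinear_def)
  have "sw2 (v \<otimes> w) F = lin_ext (\<lambda>b. lin_ext (\<lambda>c. F (basis_vec b) (basis_vec c)) w) v"
    by (simp add: tens_def sw2_lin_ext sw2_basis_vec)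
  then show ?thesis by (simp add: left right)
qed

lemma tens_universal:
  assumes "k_bilinear F"
  shows "\<exists>!L. k_linear L \<and> (\<forall>v w. L (v \<otimes> w) = F v w)"
proof (rule ex1I)
  show "k_linear (\<lambda>t. sw2 t F) \<and> (\<forall>v w. sw2 (v \<otimes> w) F = F v w)"
    using assms by (simp add: sw2_tens) (simp add: sw2_def k_linear_lin_ext)
next
  fix L assume L: "k_linear L \<and> (\<forall>v w. L (v \<otimes> w) = F v w)"
  show "L = (\<lambda>t. sw2 t F)"
  proof
    fix t
    have "L (basis_vec (b, c)) = F (basis_vec b) (basis_vec c)" for b c
      using L by (simp flip: basis_vec_tens)
    then have "(\<lambda>b. L (basis_vec b)) = (\<lambda>(b, c). F (basis_vec b) (basis_vec c))" by auto
    moreover have "L t = lin_ext (\<lambda>b. L (basis_vec b)) t"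
      using L by (intro k_linear_eq_lin_ext) simp
    ultimately show "L t = sw2 t F" by (simp add: sw2_def)
  qed
qed

definition tens_mult ::
  "(('b \<Rightarrow>\<^sub>0 'k::field) \<Rightarrow> ('b \<Rightarrow>\<^sub>0 'k) \<Rightarrow> ('b \<Rightarrow>\<^sub>0 'k)) \<Rightarrow>
   (('c \<Rightarrow>\<^sub>0 'k) \<Rightarrow> ('c \<Rightarrow>\<^sub>0 'k) \<Rightarrow> ('c \<Rightarrow>\<^sub>0 'k)) \<Rightarrow>
   ('b \<times> 'c \<Rightarrow>\<^sub>0 'k) \<Rightarrow> ('b \<times> 'c \<Rightarrow>\<^sub>0 'k) \<Rightarrow> ('b \<times> 'c \<Rightarrow>\<^sub>0 'k)"
  where "tens_mult m n s t = sw2 s (\<lambda>a b. sw2 t (\<lambda>a' b'. m a a' \<otimes> n b b'))"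

definition is_inverse :: "('v \<Rightarrow> 'v \<Rightarrow> 'v) \<Rightarrow> 'v \<Rightarrow> 'v \<Rightarrow> 'v \<Rightarrow> bool"
  where "is_inverse m u s t \<longleftrightarrow> m s t = u \<and> m t s = u"

definition the_inverse :: "('v \<Rightarrow> 'v \<Rightarrow> 'v) \<Rightarrow> 'v \<Rightarrow> 'v \<Rightarrow> 'v"
  where "the_inverse m u s = (THE t. is_inverse m u s t)"

section \<open>Quasi-Hopf algebras\<close>

record (overloaded) ('b, 'k) quasi_hopf =
  qmult :: "('b \<Rightarrow>\<^sub>0 'k::field) \<Rightarrow> ('b \<Rightarrow>\<^sub>0 'k) \<Rightarrow> ('b \<Rightarrow>\<^sub>0 'k)"
  qunit :: "'b \<Rightarrow>\<^sub>0 'k"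
  qcomult :: "('b \<Rightarrow>\<^sub>0 'k) \<Rightarrow> ('b \<times> 'b \<Rightarrow>\<^sub>0 'k)"
  qcounit :: "('b \<Rightarrow>\<^sub>0 'k) \<Rightarrow> 'k"
  qreass :: "'b \<times> 'b \<times> 'b \<Rightarrow>\<^sub>0 'k"
  qantipode :: "('b \<Rightarrow>\<^sub>0 'k) \<Rightarrow> ('b \<Rightarrow>\<^sub>0 'k)"
  qalpha :: "'b \<Rightarrow>\<^sub>0 'k"
  qbeta :: "'b \<Rightarrow>\<^sub>0 'k"

text \<open>
  The locale has no assumptions: it only provides notation for the components of \<open>H\<close>.
\<close>

locale quasi_hopf_notation =
  fixes H :: "('b, 'k::field) quasi_hopf"
begin

abbreviation mul (infixl \<open>\<cdot>\<close> 75) where "a \<cdot> b \<equiv> qmult H a b"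
abbreviation one (\<open>\<one>\<close>) where "\<one> \<equiv> qunit H"
abbreviation Delta (\<open>\<Delta>\<close>) where "\<Delta> \<equiv> qcomult H"
abbreviation counit (\<open>\<epsilon>\<close>) where "\<epsilon> \<equiv> qcounit H"
abbreviation reass (\<open>\<Phi>\<close>) where "\<Phi> \<equiv> qreass H"
abbreviation S where "S \<equiv> qantipode H"
abbreviation alph (\<open>\<alpha>\<close>) where "\<alpha> \<equiv> qalpha H"
abbreviation bet (\<open>\<beta>\<close>) where "\<beta> \<equiv> qbeta H"

definition mult2 :: "('b \<times> 'b \<Rightarrow>\<^sub>0 'k) \<Rightarrow> ('b \<times> 'b \<Rightarrow>\<^sub>0 'k) \<Rightarrow> ('b \<times> 'b \<Rightarrow>\<^sub>0 'k)"
    (infixl \<open>\<cdot>\<^sub>2\<close> 65)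
  where "mult2 = tens_mult (qmult H) (qmult H)"

definition mult3 ::
    "('b \<times> 'b \<times> 'b \<Rightarrow>\<^sub>0 'k) \<Rightarrow> ('b \<times> 'b \<times> 'b \<Rightarrow>\<^sub>0 'k) \<Rightarrow> ('b \<times> 'b \<times> 'b \<Rightarrow>\<^sub>0 'k)"
    (infixl \<open>\<cdot>\<^sub>3\<close> 65)
  where "mult3 = tens_mult (qmult H) mult2"

definition mult4 ::
    "('b \<times> 'b \<times> 'b \<times> 'b \<Rightarrow>\<^sub>0 'k) \<Rightarrow> ('b \<times> 'b \<times> 'b \<times> 'b \<Rightarrow>\<^sub>0 'k) \<Rightarrow>
      ('b \<times> 'b \<times> 'b \<times> 'b \<Rightarrow>\<^sub>0 'k)"
    (infixl \<open>\<cdot>\<^sub>4\<close> 65)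
  where "mult4 = tens_mult (qmult H) mult3"

definition reass_inv :: "'b \<times> 'b \<times> 'b \<Rightarrow>\<^sub>0 'k"  (\<open>\<Phi>inv\<close>)
  where "\<Phi>inv = the_inverse mult3 (\<one> \<otimes> \<one> \<otimes> \<one>) \<Phi>"

definition algebra_axioms :: bool
  where "algebra_axioms \<longleftrightarrow>
    k_bilinear (qmult H) \<and>
    (\<forall>a b c. (a \<cdot> b) \<cdot> c = a \<cdot> (b \<cdot> c)) \<and>
    (\<forall>a. \<one> \<cdot> a = a \<and> a \<cdot> \<one> = a)"

definition quasi_bialgebra :: bool
  where "quasi_bialgebra \<longleftrightarrow>
    algebra_axioms \<and>
    (\<exists>t. is_inverse mult3 (\<one> \<otimes> \<one> \<otimes> \<one>) \<Phi> t) \<and>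
    k_linear \<Delta> \<and> (\<forall>a b. \<Delta> (a \<cdot> b) = \<Delta> a \<cdot>\<^sub>2 \<Delta> b) \<and> \<Delta> \<one> = \<one> \<otimes> \<one> \<and>
    k_linear_form \<epsilon> \<and> (\<forall>a b. \<epsilon> (a \<cdot> b) = \<epsilon> a * \<epsilon> b) \<and> \<epsilon> \<one> = 1 \<and>
    (\<forall>h. sw2 (\<Delta> h) (\<lambda>h1 h2. h1 \<otimes> \<Delta> h2) =
       \<Phi> \<cdot>\<^sub>3 sw2 (\<Delta> h) (\<lambda>h1 h2. sw2 (\<Delta> h1) (\<lambda>h11 h12. h11 \<otimes> h12 \<otimes> h2)) \<cdot>\<^sub>3 \<Phi>inv) \<and>
    (\<forall>h. sw2 (\<Delta> h) (\<lambda>h1 h2. smul (\<epsilon> h2) h1) = h \<and> sw2 (\<Delta> h) (\<lambda>h1 h2. smul (\<epsilon> h1) h2) = h) \<and>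
    (\<one> \<otimes> \<Phi>)
      \<cdot>\<^sub>4 sw3 \<Phi> (\<lambda>X1 X2 X3. sw2 (\<Delta> X2) (\<lambda>X21 X22. X1 \<otimes> X21 \<otimes> X22 \<otimes> X3))
      \<cdot>\<^sub>4 sw3 \<Phi> (\<lambda>X1 X2 X3. X1 \<otimes> X2 \<otimes> X3 \<otimes> \<one>)
    = sw3 \<Phi> (\<lambda>X1 X2 X3. X1 \<otimes> X2 \<otimes> \<Delta> X3)
      \<cdot>\<^sub>4 sw3 \<Phi> (\<lambda>X1 X2 X3. sw2 (\<Delta> X1) (\<lambda>X11 X12. X11 \<otimes> X12 \<otimes> X2 \<otimes> X3)) \<and>
    sw3 \<Phi> (\<lambda>X1 X2 X3. smul (\<epsilon> X2) (X1 \<otimes> X3)) = \<one> \<otimes> \<one>"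

definition quasi_hopf_algebra :: bool
  where "quasi_hopf_algebra \<longleftrightarrow>
    quasi_bialgebra \<and>
    k_linear S \<and> (\<forall>a b. S (a \<cdot> b) = S b \<cdot> S a) \<and> S \<one> = \<one> \<and>
    (\<forall>h. sw2 (\<Delta> h) (\<lambda>h1 h2. S h1 \<cdot> \<alpha> \<cdot> h2) = smul (\<epsilon> h) \<alpha>) \<and>
    (\<forall>h. sw2 (\<Delta> h) (\<lambda>h1 h2. h1 \<cdot> \<beta> \<cdot> S h2) = smul (\<epsilon> h) \<beta>) \<and>
    sw3 \<Phi> (\<lambda>X1 X2 X3. X1 \<cdot> \<beta> \<cdot> S X2 \<cdot> \<alpha> \<cdot> X3) = \<one> \<and>
    sw3 \<Phi>inv (\<lambda>x1 x2 x3. S x1 \<cdot> \<alpha> \<cdot> x2 \<cdot> \<beta> \<cdot> S x3) = \<one>"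

definition involutory :: bool
  where "involutory \<longleftrightarrow> quasi_hopf_algebra \<and> (\<forall>h. S (S h) = S \<beta> \<cdot> \<alpha> \<cdot> h \<cdot> \<beta> \<cdot> S \<alpha>)"

subsection \<open>Twist and related elements\<close>

definition A_elt :: "'b \<times> 'b \<times> 'b \<times> 'b \<Rightarrow>\<^sub>0 'k"
  where "A_elt = sw3 \<Phi> (\<lambda>X1 X2 X3. X1 \<otimes> X2 \<otimes> X3 \<otimes> \<one>)
    \<cdot>\<^sub>4 sw3 \<Phi>inv (\<lambda>x1 x2 x3. sw2 (\<Delta> x1) (\<lambda>x11 x12. x11 \<otimes> x12 \<otimes> x2 \<otimes> x3))"

definition gamma_elt :: "'b \<times> 'b \<Rightarrow>\<^sub>0 'k"  (\<open>\<gamma>\<close>)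
  where "\<gamma> = sw4 A_elt (\<lambda>A1 A2 A3 A4. (S A2 \<cdot> \<alpha> \<cdot> A3) \<otimes> (S A1 \<cdot> \<alpha> \<cdot> A4))"

definition f_elt :: "'b \<times> 'b \<Rightarrow>\<^sub>0 'k"
  where "f_elt = sw3 \<Phi>inv (\<lambda>x1 x2 x3.
    sw2 (\<Delta> x1) (\<lambda>x11 x12. S x12 \<otimes> S x11) \<cdot>\<^sub>2 \<gamma> \<cdot>\<^sub>2 \<Delta> (x2 \<cdot> \<beta> \<cdot> S x3))"

definition f_inv :: "'b \<times> 'b \<Rightarrow>\<^sub>0 'k"
  where "f_inv = the_inverse mult2 (\<one> \<otimes> \<one>) f_elt"

definition p_R :: "'b \<times> 'b \<Rightarrow>\<^sub>0 'k"
  where "p_R = sw3 \<Phi>inv (\<lambda>x1 x2 x3. x1 \<otimes> (x2 \<cdot> \<beta> \<cdot> S x3))"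

definition q_R :: "'b \<times> 'b \<Rightarrow>\<^sub>0 'k"
  where "q_R = sw3 \<Phi> (\<lambda>X1 X2 X3. X1 \<otimes> (inv S (\<alpha> \<cdot> X3) \<cdot> X2))"

subsection \<open>Bosonisation\<close>

definition act :: "('b \<Rightarrow>\<^sub>0 'k) \<Rightarrow> ('b \<Rightarrow>\<^sub>0 'k) \<Rightarrow> ('b \<Rightarrow>\<^sub>0 'k)"  (infixr \<open>\<triangleright>\<close> 72)
  where "h \<triangleright> h' = sw2 (\<Delta> h) (\<lambda>h1 h2. h1 \<cdot> h' \<cdot> S h2)"

definition circ :: "('b \<Rightarrow>\<^sub>0 'k) \<Rightarrow> ('b \<Rightarrow>\<^sub>0 'k) \<Rightarrow> ('b \<Rightarrow>\<^sub>0 'k)"  (infixl \<open>\<odot>\<close> 71)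
  where "h \<odot> h' =
    sw3 \<Phi> (\<lambda>X1 X2 X3. sw3 \<Phi>inv (\<lambda>x1 x2 x3. sw2 (\<Delta> X3) (\<lambda>X31 X32.
      X1 \<cdot> h \<cdot> S (x1 \<cdot> X2) \<cdot> \<alpha> \<cdot> x2 \<cdot> X31 \<cdot> h' \<cdot> S (x3 \<cdot> X32))))"

text \<open>The braided coproduct and antipode of \<open>H\<^sub>0\<close>, for an R-matrix \<open>R\<close> of \<open>H\<close>.\<close>

definition braided_comult :: "('b \<times> 'b \<Rightarrow>\<^sub>0 'k) \<Rightarrow> ('b \<Rightarrow>\<^sub>0 'k) \<Rightarrow> ('b \<times> 'b \<Rightarrow>\<^sub>0 'k)"
  where "braided_comult R b =
    sw3 \<Phi>inv (\<lambda>x1 x2 x3. sw3 \<Phi> (\<lambda>X1 X2 X3. sw3 \<Phi>inv (\<lambda>y1 y2 y3.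
    sw2 R (\<lambda>R1 R2. sw2 f_inv (\<lambda>G1 G2. sw2 (\<Delta> b) (\<lambda>b1 b2. sw2 (\<Delta> X3) (\<lambda>X31 X32.
      (x1 \<cdot> X1 \<cdot> b1 \<cdot> G1 \<cdot> S (x2 \<cdot> R2 \<cdot> y3 \<cdot> X32))
      \<otimes> ((x3 \<cdot> R1) \<triangleright> (y1 \<cdot> X2 \<cdot> b2 \<cdot> G2 \<cdot> S (y2 \<cdot> X31))))))))))"

definition braided_antipode :: "('b \<times> 'b \<Rightarrow>\<^sub>0 'k) \<Rightarrow> ('b \<Rightarrow>\<^sub>0 'k) \<Rightarrow> ('b \<Rightarrow>\<^sub>0 'k)"
  where "braided_antipode R b =
    sw3 \<Phi> (\<lambda>X1 X2 X3. sw2 R (\<lambda>R1 R2. sw2 p_R (\<lambda>p1 p2. sw2 q_R (\<lambda>q1 q2.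
      X1 \<cdot> R2 \<cdot> p2 \<cdot> S (q1 \<cdot> ((X2 \<cdot> R1 \<cdot> p1) \<triangleright> b) \<cdot> S q2 \<cdot> X3)))))"

definition bos_mult ::
    "('b \<times> 'b \<Rightarrow>\<^sub>0 'k) \<Rightarrow> ('b \<times> 'b \<Rightarrow>\<^sub>0 'k) \<Rightarrow> ('b \<times> 'b \<Rightarrow>\<^sub>0 'k)"
  where "bos_mult u v =
    sw2 u (\<lambda>b h. sw2 v (\<lambda>b' h'. sw3 \<Phi>inv (\<lambda>x1 x2 x3. sw2 (\<Delta> h) (\<lambda>h1 h2.
      ((x1 \<triangleright> b) \<odot> ((x2 \<cdot> h1) \<triangleright> b')) \<otimes> (x3 \<cdot> h2 \<cdot> h')))))"

definition bos_comult ::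
    "('b \<times> 'b \<Rightarrow>\<^sub>0 'k) \<Rightarrow> ('b \<times> 'b \<Rightarrow>\<^sub>0 'k) \<Rightarrow> (('b \<times> 'b) \<times> ('b \<times> 'b) \<Rightarrow>\<^sub>0 'k)"
  where "bos_comult R u =
    sw2 u (\<lambda>b h. sw3 \<Phi>inv (\<lambda>y1 y2 y3. sw3 \<Phi> (\<lambda>X1 X2 X3. sw3 \<Phi> (\<lambda>Y1 Y2 Y3.
    sw2 R (\<lambda>R1 R2. sw3 \<Phi>inv (\<lambda>x1 x2 x3.
    sw2 (braided_comult R b) (\<lambda>b1 b2. sw2 (\<Delta> X3) (\<lambda>X31 X32.
    sw2 (\<Delta> h) (\<lambda>h1 h2. sw2 (\<Delta> y3) (\<lambda>y31 y32.
      (((y1 \<cdot> X1) \<triangleright> b1) \<otimes> (y2 \<cdot> Y1 \<cdot> R2 \<cdot> x2 \<cdot> X31 \<cdot> h1))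
      \<otimes> (((y31 \<cdot> Y2 \<cdot> R1 \<cdot> x1 \<cdot> X2) \<triangleright> b2) \<otimes> (y32 \<cdot> Y3 \<cdot> x3 \<cdot> X32 \<cdot> h2))))))))))))"

definition bos_antipode ::
    "('b \<times> 'b \<Rightarrow>\<^sub>0 'k) \<Rightarrow> ('b \<times> 'b \<Rightarrow>\<^sub>0 'k) \<Rightarrow> ('b \<times> 'b \<Rightarrow>\<^sub>0 'k)"
  where "bos_antipode R u =
    sw2 u (\<lambda>b h. sw3 \<Phi> (\<lambda>X1 X2 X3. sw3 \<Phi>inv (\<lambda>x1 x2 x3. sw2 R (\<lambda>R1 R2.
    sw2 (\<Delta> x1) (\<lambda>x11 x12.
      bos_mult
        (\<beta> \<otimes> (S (X1 \<cdot> x11 \<cdot> R2 \<cdot> h) \<cdot> \<alpha>))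
        (((X2 \<cdot> x12 \<cdot> R1) \<triangleright> braided_antipode R b) \<otimes> (X3 \<cdot> x2 \<cdot> \<beta> \<cdot> S x3)))))))"

definition bos :: "('b \<times> 'b \<Rightarrow>\<^sub>0 'k) \<Rightarrow> ('b \<times> 'b, 'k) quasi_hopf"
  where "bos R =
    \<lparr> qmult = bos_mult,
      qunit = \<beta> \<otimes> \<one>,
      qcomult = bos_comult R,
      qcounit = lin_form (\<lambda>(b, h). \<epsilon> (basis_vec b) * \<epsilon> (basis_vec h)),
      qreass = sw3 \<Phi> (\<lambda>X1 X2 X3. (\<beta> \<otimes> X1) \<otimes> (\<beta> \<otimes> X2) \<otimes> (\<beta> \<otimes> X3)),
      qantipode = bos_antipode R,
      qalpha = \<beta> \<otimes> \<alpha>,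
      qbeta = \<beta> \<otimes> \<beta> \<rparr>"

end

abbreviation "quasi_hopf_algebra \<equiv> quasi_hopf_notation.quasi_hopf_algebra"
abbreviation "involutory \<equiv> quasi_hopf_notation.involutory"
abbreviation "bos \<equiv> quasi_hopf_notation.bos"

definition quasi_hopf_iso ::
  "(('b \<Rightarrow>\<^sub>0 'k::field) \<Rightarrow> ('c \<Rightarrow>\<^sub>0 'k)) \<Rightarrow> ('b, 'k) quasi_hopf \<Rightarrow> ('c, 'k) quasi_hopf \<Rightarrow> bool"
  where "quasi_hopf_iso \<phi> A B \<longleftrightarrow>
    k_linear \<phi> \<and> bij \<phi> \<and>
    (\<forall>a b. \<phi> (qmult A a b) = qmult B (\<phi> a) (\<phi> b)) \<and> \<phi> (qunit A) = qunit B \<and>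
    (\<forall>a. qcomult B (\<phi> a) = sw2 (qcomult A a) (\<lambda>a1 a2. \<phi> a1 \<otimes> \<phi> a2)) \<and>
    (\<forall>a. qcounit B (\<phi> a) = qcounit A a) \<and>
    sw3 (qreass A) (\<lambda>X1 X2 X3. \<phi> X1 \<otimes> \<phi> X2 \<otimes> \<phi> X3) = qreass B \<and>
    (\<forall>a. \<phi> (qantipode A a) = qantipode B (\<phi> a)) \<and>
    \<phi> (qalpha A) = qalpha B \<and> \<phi> (qbeta A) = qbeta B"

section \<open>Group algebras with a reassociator from an element of order two\<close>

text \<open>
  For an additively written group \<open>'g\<close>, \<open>'g \<Rightarrow>\<^sub>0 'k\<close> with its library product (convolution) is the
  group algebra, and \<open>basis_vec g\<close> is the group element \<open>g\<close>. The groups used are \<open>bit\<close> (order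
  two, non-trivial element \<open>1\<close>) and \<open>bit \<times> bit\<close>.
\<close>

definition p_minus :: "'g::monoid_add \<Rightarrow> ('g \<Rightarrow>\<^sub>0 'k::field)"
  where "p_minus x = smul (1 / 2) (1 - basis_vec x)"

definition group_quasi_hopf :: "'g::monoid_add \<Rightarrow> ('g, 'k::field) quasi_hopf"
  where "group_quasi_hopf x =
    \<lparr> qmult = (*),
      qunit = 1,
      qcomult = lin_ext (\<lambda>g. basis_vec (g, g)),
      qcounit = lin_form (\<lambda>g. 1),
      qreass = 1 \<otimes> 1 \<otimes> 1 - smul 2 (p_minus x \<otimes> p_minus x \<otimes> p_minus x),
      qantipode = id,
      qalpha = basis_vec x,
      qbeta = 1 \<rparr>"

definition H2 :: "(bit, 'k::field) quasi_hopf"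
  where "H2 = group_quasi_hopf 1"

definition R_plus :: "'k::field \<Rightarrow> (bit \<times> bit \<Rightarrow>\<^sub>0 'k)"
  where "R_plus i = 1 \<otimes> 1 - smul (1 + i) (p_minus 1 \<otimes> p_minus 1)"

definition R_minus :: "'k::field \<Rightarrow> (bit \<times> bit \<Rightarrow>\<^sub>0 'k)"
  where "R_minus i = 1 \<otimes> 1 - smul (1 - i) (p_minus 1 \<otimes> p_minus 1)"

abbreviation kC2C2 :: "bit \<times> bit \<Rightarrow> (bit \<times> bit, 'k::field) quasi_hopf"
  where "kC2C2 x \<equiv> group_quasi_hopf x"

definition primitive_root_of_unity :: "nat \<Rightarrow> 'k::field \<Rightarrow> bool"
  where "primitive_root_of_unity n z \<longleftrightarrow> z ^ n = 1 \<and> (\<forall>m. 0 < m \<and> m < n \<longrightarrow> z ^ m \<noteq> 1)"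

end

theory Submission
  imports Defs
begin

text \<open>
  \<open>H(2)\<close> is commutative with antipode the identity, and \<open>g\<^sup>2 = 1\<close> for every group element \<open>g\<close>, so
  the adjoint action is trivial: \<open>h \<triangleright> b = \<epsilon>(h) b\<close>. Consequently almost every tensor leg in the
  formulas for the bosonisation is absorbed by a counit; the R-matrix disappears because
  \<open>\<epsilon>(p\<^sub>-) = 0\<close>. What remains is \<open>x\<^sup>1 x\<^sup>2 x\<^sup>3 \<alpha> = g g = 1\<close>, hence \<open>h \<circ> h' = h h'\<close>, and the twist
  \<open>f = 1 - 2 p\<^sub>- \<otimes> p\<^sub>-\<close>, which cancels the reassociators in the braided coproduct, leaving
  \<open>\<Delta>\<close>. So the bosonisation is literally the group algebra of \<open>C\<^sub>2 \<times> C\<^sub>2\<close> with the reassociator of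
  the second generator, and exchanging the factors gives the other generator. Everything works for
  an arbitrary group of exponent two in place of \<open>C\<^sub>2\<close>; this generality covers both \<open>H(2)\<close> and
  \<open>k[C\<^sub>2 \<times> C\<^sub>2]\<close>.
\<close>

section \<open>Linear maps on based spaces\<close>

lemma k_linear_iff:
  "k_linear L \<longleftrightarrow> (\<forall>u v. L (u + v) = L u + L v) \<and> (\<forall>c v. L (smul c v) = smul c (L v))"
  for L :: "('b \<Rightarrow>\<^sub>0 'k::field) \<Rightarrow> ('c \<Rightarrow>\<^sub>0 'k)"
  using vector_space_smul[where 'k = 'k and 'b = 'b] vector_space_smul[where 'k = 'k and 'b = 'c]
  by (simp add: Vector_Spaces.linear_iff)

lemma k_linear_form_iff:
  "k_linear_form L \<longleftrightarrow> (\<forall>u v. L (u + v) = L u + L v) \<and> (\<forall>c v. L (smul c v) = c * L v)"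
  for L :: "('b \<Rightarrow>\<^sub>0 'k::field) \<Rightarrow> 'k"
  using vector_space_smul[where 'k = 'k and 'b = 'b]
  by (simp add: Vector_Spaces.linear_iff vector_space_def algebra_simps)

lemma smul_eq_mult: "smul c v = Poly_Mapping.single 0 c * (v :: 'g::monoid_add \<Rightarrow>\<^sub>0 'k::field)"
  unfolding smul_def by (rule mult_map_scale_conv_mult)

lemma smul_one [simp]: "smul 1 v = v"
  by (rule poly_mapping_eqI) simp

lemma smul_zero_left [simp]: "smul 0 v = 0"
  by (rule poly_mapping_eqI) simp

lemma smul_zero_right [simp]: "smul c 0 = 0"
  by (rule poly_mapping_eqI) simp

lemma smul_smul: "smul c (smul d v) = smul (c * d) v"
  by (rule poly_mapping_eqI) (simp add: mult.assoc)

lemma smul_add: "smul c (u + v) = smul c u + smul c v"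
  by (rule poly_mapping_eqI) (simp add: lookup_add algebra_simps)

lemma smul_diff: "smul c (u - v) = smul c u - smul c v"
  by (rule poly_mapping_eqI) (simp add: lookup_minus algebra_simps)

lemma smul_minus [simp]: "smul c (- v) = - smul c v"
  by (rule poly_mapping_eqI) simp

lemma smul_left_commute: "smul c (smul d v) = smul d (smul c v)"
  by (simp add: smul_smul mult.commute)

lemma mult_smul_left [simp]:
  "smul c u * v = smul c (u * v :: 'g::comm_monoid_add \<Rightarrow>\<^sub>0 'k::field)"
  by (simp add: smul_eq_mult mult.assoc)

lemma mult_smul_right [simp]:
  "u * smul c v = smul c (u * v :: 'g::comm_monoid_add \<Rightarrow>\<^sub>0 'k::field)"
  by (simp add: smul_eq_mult mult_ac)

lemma lin_ext_add: "lin_ext f (u + v) = lin_ext f u + lin_ext f v"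
  and lin_ext_smul: "lin_ext f (smul c v) = smul c (lin_ext f v)"
  using k_linear_lin_ext[of f] by (auto simp: k_linear_iff)

text \<open>A form is a linear map into the one-dimensional space with basis \<open>()\<close>, so
  its linearity is inherited from \<open>lin_ext\<close>.\<close>

lemma lin_form_eq_lookup:
  "lin_form f v = Poly_Mapping.lookup (lin_ext (\<lambda>b. Poly_Mapping.single () (f b)) v) ()"
  by (simp add: lin_form_def lin_ext_def lookup_sum)

lemma lin_form_add: "lin_form f (u + v) = lin_form f u + lin_form f v"
  and lin_form_smul: "lin_form f (smul c v) = c * lin_form f v"
  by (simp_all add: lin_form_eq_lookup lin_ext_add lin_ext_smul lookup_add)

lemma lin_form_basis_vec [simp]: "lin_form f (basis_vec b) = f b"
  by (simp add: lin_form_def)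

lemma lin_ext_add_fun: "lin_ext (\<lambda>b. f b + g b) v = lin_ext f v + lin_ext g v"
  by (simp add: lin_ext_def smul_add sum.distrib)

lemma lin_ext_smul_fun: "lin_ext (\<lambda>b. smul c (f b)) v = smul c (lin_ext f v)"
  by (rule poly_mapping_eqI)
    (simp add: lin_ext_def lookup_sum sum_distrib_left mult.left_commute)

lemma k_linear_eqI:
  assumes "k_linear L" "k_linear M" "\<And>b. L (basis_vec b) = M (basis_vec b)"
  shows "L v = M v"
  using k_linear_eq_lin_ext[OF assms(1), of v] k_linear_eq_lin_ext[OF assms(2), of v] assms(3)
  by simp

lemma k_linear_form_eqI:
  assumes "k_linear_form L" "k_linear_form M" "\<And>b. L (basis_vec b) = M (basis_vec b)"
  shows "L v = M v"
proof -
  have "smul (L v) (basis_vec ()) = smul (M v) (basis_vec ())"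
    using assms
    by (intro k_linear_eqI[where v = v and L = "\<lambda>v. smul (L v) (basis_vec ())"])
      (auto simp: k_linear_iff k_linear_form_iff lookup_add algebra_simps intro!: poly_mapping_eqI)
  then have "Poly_Mapping.lookup (smul (L v) (basis_vec ())) () =
      Poly_Mapping.lookup (smul (M v) (basis_vec ())) ()"
    by (rule arg_cong)
  then show ?thesis by simp
qed

section \<open>Closure rules for linear maps\<close>

named_theorems k_linear_intros

lemma k_linear_id [k_linear_intros]: "k_linear (\<lambda>v. v)"
  by (simp add: k_linear_iff)

lemma k_linear_smul [k_linear_intros]: "k_linear L \<Longrightarrow> k_linear (\<lambda>v. smul c (L v))"
  by (simp add: k_linear_iff smul_add smul_left_commute)

lemma k_linear_lin_form [k_linear_intros]: "k_linear L \<Longrightarrow> k_linear (\<lambda>v. smul (lin_form f (L v)) w)"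
  by (auto simp: k_linear_iff lin_form_add lin_form_smul smul_smul lookup_add algebra_simps
      intro!: poly_mapping_eqI)

text \<open>The premise moves the constant left factor onto the vector, so products of counit values
  are peeled off one by one until \<open>k_linear_lin_form\<close> applies.\<close>

lemma k_linear_lin_form_mult [k_linear_intros]:
  "k_linear (\<lambda>v. smul (b v) (smul a w)) \<Longrightarrow> k_linear (\<lambda>v. smul (a * b v) w)"
  by (simp add: smul_smul mult.commute)

lemma k_linear_add [k_linear_intros]: "k_linear L \<Longrightarrow> k_linear M \<Longrightarrow> k_linear (\<lambda>v. L v + M v)"
  by (simp add: k_linear_iff smul_add)

lemma k_linear_diff [k_linear_intros]: "k_linear L \<Longrightarrow> k_linear M \<Longrightarrow> k_linear (\<lambda>v. L v - M v)"
  by (simp add: k_linear_iff smul_diff)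

lemma k_linear_zero [k_linear_intros]: "k_linear (\<lambda>v. 0)"
  by (simp add: k_linear_iff)

lemma k_linear_mult_left [k_linear_intros]:
  fixes w :: "'g::comm_monoid_add \<Rightarrow>\<^sub>0 'k::field"
  shows "k_linear L \<Longrightarrow> k_linear (\<lambda>v. L v * w)"
  by (simp add: k_linear_iff distrib_right)

lemma k_linear_mult_right [k_linear_intros]:
  fixes w :: "'g::comm_monoid_add \<Rightarrow>\<^sub>0 'k::field"
  shows "k_linear L \<Longrightarrow> k_linear (\<lambda>v. w * L v)"
  by (simp add: k_linear_iff distrib_left)

lemma k_linear_lin_ext' [k_linear_intros]: "k_linear L \<Longrightarrow> k_linear (\<lambda>v. lin_ext f (L v))"
  using k_linear_compose[OF _ k_linear_lin_ext] .

text \<open>The sum runs over the keys of \<open>w\<close>, which do not vary with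
  \<open>v\<close>.\<close>

lemma k_linear_lin_ext_fun:
  assumes "\<And>b. k_linear (\<lambda>v. F v b)"
  shows "k_linear (\<lambda>v. lin_ext (F v) w)"
proof -
  have "F (u + v) = (\<lambda>b. F u b + F v b)" "F (smul c v) = (\<lambda>b. smul c (F v b))" for u v c
    using assms by (auto simp: k_linear_iff)
  then show ?thesis by (simp add: k_linear_iff lin_ext_add_fun lin_ext_smul_fun)
qed

lemma k_linear_sw2 [k_linear_intros]: "k_linear L \<Longrightarrow> k_linear (\<lambda>v. sw2 (L v) F)"
  unfolding sw2_def by (rule k_linear_lin_ext')

lemma k_linear_sw3 [k_linear_intros]: "k_linear L \<Longrightarrow> k_linear (\<lambda>v. sw3 (L v) F)"
  unfolding sw3_def by (rule k_linear_lin_ext')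

lemma k_linear_sw4 [k_linear_intros]: "k_linear L \<Longrightarrow> k_linear (\<lambda>v. sw4 (L v) F)"
  unfolding sw4_def by (rule k_linear_lin_ext')

lemma k_linear_sw2_fun [k_linear_intros]:
  "(\<And>a b. k_linear (\<lambda>v. F v a b)) \<Longrightarrow> k_linear (\<lambda>v. sw2 t (F v))"
  unfolding sw2_def by (rule k_linear_lin_ext_fun) auto

lemma k_linear_sw3_fun [k_linear_intros]:
  "(\<And>a b c. k_linear (\<lambda>v. F v a b c)) \<Longrightarrow> k_linear (\<lambda>v. sw3 t (F v))"
  unfolding sw3_def by (rule k_linear_lin_ext_fun) auto

lemma k_linear_tens_left [k_linear_intros]: "k_linear L \<Longrightarrow> k_linear (\<lambda>v. L v \<otimes> w)"
  unfolding tens_def by (rule k_linear_lin_ext')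

lemma k_linear_tens_right [k_linear_intros]: "k_linear L \<Longrightarrow> k_linear (\<lambda>v. w \<otimes> L v)"
  unfolding tens_def by (intro k_linear_lin_ext_fun k_linear_lin_ext')

lemma k_linear_imp_diff: "k_linear L \<Longrightarrow> L (u - v) = L u - L v"
  by (metis k_linear_iff add_diff_cancel_right' diff_add_cancel)

section \<open>Evaluation of Sweedler sums\<close>

lemma sw3_basis_vec [simp]: "sw3 (basis_vec (a, b, c)) F = F (basis_vec a) (basis_vec b) (basis_vec c)"
  by (simp add: sw3_def)

lemma sw4_basis_vec [simp]:
  "sw4 (basis_vec (a, b, c, d)) F = F (basis_vec a) (basis_vec b) (basis_vec c) (basis_vec d)"
  by (simp add: sw4_def)

lemma sw2_linear:
  "sw2 (t + t') F = sw2 t F + sw2 t' F" "sw2 (t - t') F = sw2 t F - sw2 t' F"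
  "sw2 (smul c t) F = smul c (sw2 t F)"
  using k_linear_sw2[OF k_linear_id, of F] k_linear_imp_diff[OF k_linear_sw2[OF k_linear_id, of F]]
  by (simp_all add: k_linear_iff)

lemma sw3_linear:
  "sw3 (t - t') F = sw3 t F - sw3 t' F" "sw3 (smul c t) F = smul c (sw3 t F)"
  using k_linear_sw3[OF k_linear_id, of F] k_linear_imp_diff[OF k_linear_sw3[OF k_linear_id, of F]]
  by (simp_all add: k_linear_iff)

lemma sw4_linear:
  "sw4 (t + t') F = sw4 t F + sw4 t' F" "sw4 (t - t') F = sw4 t F - sw4 t' F"
  "sw4 (smul c t) F = smul c (sw4 t F)"
  using k_linear_sw4[OF k_linear_id, of F] k_linear_imp_diff[OF k_linear_sw4[OF k_linear_id, of F]]
  by (simp_all add: k_linear_iff)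

declare sw2_basis_vec [simp] basis_vec_tens [simp]

lemma sw2_tens':
  assumes "\<And>b. k_linear (\<lambda>a. F a b)" "\<And>a. k_linear (F a)"
  shows "sw2 (v \<otimes> w) F = F v w"
  using assms by (intro sw2_tens) (simp add: k_bilinear_def)

lemma sw3_tens:
  assumes "\<And>b c. k_linear (\<lambda>a. F a b c)" "\<And>a c. k_linear (\<lambda>b. F a b c)"
    "\<And>a b. k_linear (F a b)"
  shows "sw3 (u \<otimes> v \<otimes> w) F = F u v w"
proof -
  \<comment> \<open>Tensor products nest to the right, so the second leg of a twofold sum is itself
    a tensor that a further sum splits.\<close>
  have 1: "sw3 t F = sw2 t (\<lambda>a s. sw2 s (F a))" for t
    by (rule k_linear_eqI[of "\<lambda>t. sw3 t F"]) (auto intro!: k_linear_intros)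
  show ?thesis unfolding 1
    by (subst sw2_tens'; (intro k_linear_intros assms sw2_tens')?)
qed

lemma sw4_tens:
  assumes "\<And>b c d. k_linear (\<lambda>a. F a b c d)" "\<And>a c d. k_linear (\<lambda>b. F a b c d)"
    "\<And>a b d. k_linear (\<lambda>c. F a b c d)" "\<And>a b c. k_linear (F a b c)"
  shows "sw4 (t \<otimes> u \<otimes> v \<otimes> w) F = F t u v w"
proof -
  have 1: "sw4 t F = sw2 t (\<lambda>a s. sw3 s (F a))" for t
    by (rule k_linear_eqI[of "\<lambda>t. sw4 t F"]) (auto intro!: k_linear_intros)
  show ?thesis unfolding 1
    by (subst sw2_tens'; (intro k_linear_intros assms sw3_tens)?)
qed

section \<open>Group algebras and their tensor products\<close>

lemma one_tens_one [simp]: "(1 :: 'g::monoid_add \<Rightarrow>\<^sub>0 'k::field) \<otimes> (1 :: 'h::monoid_add \<Rightarrow>\<^sub>0 'k) = 1"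
  by (simp flip: single_one add: zero_prod_def)

text \<open>On basis vectors both products add indices componentwise. Tensor powers of a group
  algebra thus become commutative rings under the library product, and ring normalisation applies to
  them.\<close>

lemma tens_mult_eq:
  "tens_mult (*) (*) s t = s * (t :: 'g::comm_monoid_add \<times> 'h::comm_monoid_add \<Rightarrow>\<^sub>0 'k::field)"
proof -
  have mult_basis_vec: "sw2 t (\<lambda>c d. (basis_vec a * c) \<otimes> (basis_vec b * d)) = basis_vec (a, b) * t"
    for a :: 'g and b :: 'h
    by (rule k_linear_eqI[where v = t and M = "\<lambda>t. basis_vec (a, b) * t"])
      (auto simp: mult_single intro!: k_linear_intros)
  show ?thesis
    unfolding tens_mult_def
    by (rule k_linear_eqI[where v = s and M = "\<lambda>s. s * t"])
      (auto simp: mult_basis_vec intro!: k_linear_intros)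
qed

lemma tens_times_tens:
  fixes a c :: "'g::comm_monoid_add \<Rightarrow>\<^sub>0 'k::field" and b d :: "'h::comm_monoid_add \<Rightarrow>\<^sub>0 'k"
  shows "(a \<otimes> b) * (c \<otimes> d) = (a * c) \<otimes> (b * d)"
  unfolding tens_mult_eq[symmetric] tens_mult_def by (subst sw2_tens'; intro k_linear_intros sw2_tens')+

lemma tens_times_tens_left:
  fixes a c :: "'g::comm_monoid_add \<Rightarrow>\<^sub>0 'k::field" and b d :: "'h::comm_monoid_add \<Rightarrow>\<^sub>0 'k"
  shows "(a \<otimes> b) * ((c \<otimes> d) * w) = ((a * c) \<otimes> (b * d)) * w"
  by (simp add: tens_times_tens flip: mult.assoc)

text \<open>The simplifier eta-contracts its goals, after which the rules above no longer match.\<close>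

lemmas k_linear_eta = k_linear_smul[OF k_linear_id] k_linear_tens_right[OF k_linear_id]
  k_linear_mult_right[OF k_linear_id]

text \<open>Lets ring normalisation collect terms whose coefficients are numeric scalars.\<close>

lemma smul_numeral:
  "smul (numeral n) v = numeral n * (v :: 'g::monoid_add \<Rightarrow>\<^sub>0 'k::field)"
  by (simp add: smul_eq_mult)

lemma
  fixes u v :: "'a \<Rightarrow>\<^sub>0 'c::field" and w :: "'b \<Rightarrow>\<^sub>0 'c"
  shows tens_add_left: "(u + v) \<otimes> w = u \<otimes> w + v \<otimes> w"
    and tens_add_right: "w \<otimes> (u + v) = w \<otimes> u + w \<otimes> v"
    and tens_diff_left: "(u - v) \<otimes> w = u \<otimes> w - v \<otimes> w"
    and tens_diff_right: "w \<otimes> (u - v) = w \<otimes> u - w \<otimes> v"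
    and tens_smul_left: "smul c u \<otimes> w = smul c (u \<otimes> w)"
    and tens_smul_right: "w \<otimes> smul c u = smul c (w \<otimes> u)"
proof -
  have L: "k_linear (\<lambda>v :: 'a \<Rightarrow>\<^sub>0 'c. v \<otimes> w)" and R: "k_linear (\<lambda>v :: 'a \<Rightarrow>\<^sub>0 'c. w \<otimes> v)"
    by (intro k_linear_intros)+
  show "(u + v) \<otimes> w = u \<otimes> w + v \<otimes> w" "smul c u \<otimes> w = smul c (u \<otimes> w)"
    "w \<otimes> (u + v) = w \<otimes> u + w \<otimes> v" "w \<otimes> smul c u = smul c (w \<otimes> u)"
    using L R by (simp_all add: k_linear_iff)
  show "(u - v) \<otimes> w = u \<otimes> w - v \<otimes> w" "w \<otimes> (u - v) = w \<otimes> u - w \<otimes> v"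
    using k_linear_imp_diff[OF L] k_linear_imp_diff[OF R] by auto
qed

lemma tens_minus_left: "(- u) \<otimes> w = - (u \<otimes> w)"
  and tens_minus_right: "w \<otimes> (- u) = - (w \<otimes> u)"
  using tens_diff_left[of 0 u w] tens_diff_right[of w 0 u] tens_diff_left[of u u w] tens_diff_right[of w u u]
  by auto

lemma
  fixes w :: "'a \<Rightarrow>\<^sub>0 'c::field"
  shows tens_zero_left [simp]: "(0 :: 'b \<Rightarrow>\<^sub>0 'c) \<otimes> w = 0"
    and tens_zero_right [simp]: "w \<otimes> (0 :: 'b \<Rightarrow>\<^sub>0 'c) = 0"
  using tens_diff_left[of 0 "0 :: 'b \<Rightarrow>\<^sub>0 'c" w] tens_diff_right[of w 0 "0 :: 'b \<Rightarrow>\<^sub>0 'c"]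
  by auto

lemmas tens_linear = tens_add_left tens_add_right tens_diff_left tens_diff_right
  tens_minus_left tens_minus_right tens_smul_left tens_smul_right

lemma idem_left: "a * a = a \<Longrightarrow> a * (a * w) = a * (w :: 'a::comm_ring_1)"
  by (metis mult.assoc)

text \<open>In a commutative ring a one-sided inverse is two-sided and unique.\<close>

lemma the_inverse_eqI:
  fixes s t :: "'a::comm_ring_1"
  assumes "s * t = 1"
  shows "the_inverse (*) 1 s = t"
  unfolding the_inverse_def is_inverse_def
proof (rule the_equality)
  fix u assume "s * u = 1 \<and> u * s = 1"
  then show "u = t" using assms by (metis mult.assoc mult.commute mult_1_left)
qed (use assms in \<open>simp add: mult.commute\<close>)

lemma lin_form_mult:
  fixes u v :: "'g::comm_monoid_add \<Rightarrow>\<^sub>0 'k::field"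
  shows "lin_form (\<lambda>g. 1) (u * v) = lin_form (\<lambda>g. 1) u * lin_form (\<lambda>g. 1) v"
proof -
  let ?e = "lin_form (\<lambda>g::'g. 1::'k)"
  \<comment> \<open>Linearity reduces the claim to basis vectors in one argument at a time; their
    products are again basis vectors, of value 1.\<close>
  have "?e (basis_vec a * v) = ?e v" for a
    by (rule k_linear_form_eqI[where v = v and M = ?e])
      (simp_all add: mult_single k_linear_form_iff lin_form_add lin_form_smul distrib_left)
  then show ?thesis
    by (intro k_linear_form_eqI[where v = u and M = "\<lambda>u. ?e u * ?e v"])
      (simp_all add: k_linear_form_iff lin_form_add lin_form_smul algebra_simps)
qed

lemma lin_form_one [simp]: "lin_form f (1 :: 'g::monoid_add \<Rightarrow>\<^sub>0 'k::field) = f 0"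
  by (simp flip: single_one)

lemma group_quasi_hopf_simps [simp]:
  "qmult (group_quasi_hopf x) = (*)"
  "qunit (group_quasi_hopf x) = 1"
  "qcomult (group_quasi_hopf x) = lin_ext (\<lambda>g. basis_vec (g, g))"
  "qcounit (group_quasi_hopf x) = lin_form (\<lambda>g. 1)"
  "qantipode (group_quasi_hopf x) = id"
  "qalpha (group_quasi_hopf x) = basis_vec x"
  "qbeta (group_quasi_hopf x) = 1"
  by (simp_all add: group_quasi_hopf_def)

lemma comult_one [simp]: "lin_ext (\<lambda>g. basis_vec (g, g)) (1 :: 'g::monoid_add \<Rightarrow>\<^sub>0 'k::field) = 1"
  by (simp flip: single_one add: zero_prod_def)

lemma comult_mult:
  fixes u v :: "'g::comm_monoid_add \<Rightarrow>\<^sub>0 'k::field"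
  shows "lin_ext (\<lambda>g. basis_vec (g, g)) (u * v) =
    lin_ext (\<lambda>g. basis_vec (g, g)) u * lin_ext (\<lambda>g. basis_vec (g, g)) v"
proof -
  let ?D = "lin_ext (\<lambda>g::'g. basis_vec (g, g) :: _ \<Rightarrow>\<^sub>0 'k)"
  have mult_basis_vec: "?D (basis_vec a * v) = basis_vec (a, a) * ?D v" for a
    by (rule k_linear_eqI[where v = v and M = "\<lambda>v. basis_vec (a, a) * ?D v"])
      (auto simp: mult_single intro!: k_linear_intros)
  show ?thesis
    by (rule k_linear_eqI[where v = u and M = "\<lambda>u. ?D u * ?D v"])
      (auto simp: mult_basis_vec intro!: k_linear_intros)
qed

section \<open>Groups of exponent two\<close>

text \<open>\<open>H\<close> and \<open>p\<close> are parameters because \<open>x\<close> alone does not determine the coefficient field.\<close>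

locale elementary_2_group = quasi_hopf_notation H
  for H :: "('g::comm_monoid_add, 'k::field) quasi_hopf" +
  fixes x :: 'g and p :: "'g \<Rightarrow>\<^sub>0 'k"
  assumes H_def: "H = group_quasi_hopf x" and p_def: "p = p_minus x"
    and add_self: "g + g = (0::'g)" and two_neq_0: "(2::'k) \<noteq> 0"
begin

lemma H_simps [simp]:
  "qmult H = (*)" "\<one> = 1" "\<Delta> = lin_ext (\<lambda>g. basis_vec (g, g))"
  "\<epsilon> = lin_form (\<lambda>g. 1)" "S = id" "\<alpha> = basis_vec x" "\<beta> = 1"
  by (simp_all add: H_def)

lemma basis_vec_x: "basis_vec x = 1 - smul 2 p"
  using two_neq_0 by (simp add: p_def p_minus_def smul_smul)

lemma x_x [simp]:
  "basis_vec x * basis_vec x = (1 :: 'g \<Rightarrow>\<^sub>0 'k)"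
  "basis_vec x * (basis_vec x * u) = (u :: 'g \<Rightarrow>\<^sub>0 'k)"
  by (simp_all flip: mult.assoc add: mult_single add_self)

lemma p_p [simp]: "p * p = p"
proof -
  \<comment> \<open>(1 - x)^2 = 2 (1 - x), because x^2 = 1.\<close>
  have "p * p = smul (1/2) (smul (1/2) (2 * (1 - basis_vec x)))"
    unfolding p_def p_minus_def by (simp add: algebra_simps)
  also have "smul (1/2) (2 * (1 - basis_vec x)) = (1 - basis_vec x :: 'g \<Rightarrow>\<^sub>0 'k)"
    using two_neq_0 by (simp add: smul_numeral[symmetric] smul_smul)
  finally show ?thesis by (simp add: p_def p_minus_def)
qed

lemma p_p_left [simp]: "p * (p * u) = p * u"
  by (simp flip: mult.assoc)

lemma x_p [simp]: "basis_vec x * p = - p" "p * basis_vec x = - p"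
  by (simp_all add: basis_vec_x algebra_simps smul_numeral)

lemma counit_p [simp]: "lin_form (\<lambda>g. 1) p = 0"
proof -
  \<comment> \<open>The argument equals 1 and the counit of \<open>basis_vec x\<close> is 1, which
    leaves 2 \<epsilon>(p) = 0.\<close>
  have "lin_form (\<lambda>g. 1) (basis_vec x + smul 2 p) = 1"
    by (simp add: basis_vec_x)
  then show ?thesis using two_neq_0
    by (simp add: lin_form_add lin_form_smul)
qed

lemma reass_eq: "\<Phi> = 1 - smul 2 (p \<otimes> p \<otimes> p)"
  by (simp add: H_def group_quasi_hopf_def p_def)

text \<open>Both terms of \<open>\<Phi>\<close> are pure tensors. This turns the formulas of the
  bosonisation into finite expressions in \<open>p\<close>; with \<open>reass_inv_eq\<close> it
  serves \<open>\<Phi>inv\<close> as well.\<close>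

lemma sw3_reass [simp]:
  assumes "\<And>b c. k_linear (\<lambda>a. F a b c)" "\<And>a c. k_linear (\<lambda>b. F a b c)"
    "\<And>a b. k_linear (F a b)"
  shows "sw3 \<Phi> F = F 1 1 1 - smul 2 (F p p p)"
proof -
  have "sw3 1 F = F 1 1 1"
    using sw3_tens[of F 1 1 1, OF assms] by simp
  then show ?thesis
    unfolding reass_eq using sw3_tens[of F p p p, OF assms] by (simp add: sw3_linear)
qed

lemma mult2_eq: "mult2 = (*)"
  by (intro ext) (simp add: mult2_def tens_mult_eq)

lemma mult3_eq: "mult3 = (*)"
  by (intro ext) (simp add: mult3_def mult2_eq tens_mult_eq)

lemma mult4_eq: "mult4 = (*)"
  by (intro ext) (simp add: mult4_def mult3_eq tens_mult_eq)

text \<open>(1 - 2e)^2 = 1 for the idempotent e = p \<otimes> p \<otimes> p.\<close>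

lemma reass_reass: "\<Phi> * \<Phi> = 1"
  unfolding reass_eq by (simp add: tens_times_tens algebra_simps smul_numeral)

lemma reass_inv_eq: "\<Phi>inv = \<Phi>"
  unfolding reass_inv_def mult3_eq by (simp add: the_inverse_eqI reass_reass)

lemmas linear_normalize =
  tens_linear smul_add smul_diff smul_smul ring_distribs tens_times_tens mult_ac

text \<open>As rewrite rules these discharge the linearity hypotheses of \<open>sw3_reass\<close>,
  \<open>sw2_R\<close> and similar expansions.\<close>

lemmas [simp] = k_linear_intros k_linear_eta

text \<open>This is group-likeness of x = 1 - 2p, solved for \<open>p\<close>.\<close>

lemma comult_p [simp]:
  "lin_ext (\<lambda>g. basis_vec (g, g)) p = p \<otimes> 1 + 1 \<otimes> p - smul 2 (p \<otimes> p)"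
proof -
  let ?D = "lin_ext (\<lambda>g. basis_vec (g, g)) :: _ \<Rightarrow> _ \<Rightarrow>\<^sub>0 'k"
  have "?D (basis_vec x) = (1 - smul 2 p) \<otimes> (1 - smul 2 p)"
    by (simp flip: basis_vec_x)
  also have "\<dots> = 1 - smul 2 (p \<otimes> 1 + 1 \<otimes> p - smul 2 (p \<otimes> p))"
    by (simp add: tens_linear smul_add smul_diff)
  finally have "smul (1/2) (1 - ?D (basis_vec x)) = p \<otimes> 1 + 1 \<otimes> p - smul 2 (p \<otimes> p)"
    using two_neq_0 by (simp add: smul_smul)
  then show ?thesis
    by (simp add: p_def p_minus_def lin_ext_smul k_linear_imp_diff[OF k_linear_lin_ext])
qed

text \<open>Stated for the expanded tensor because \<open>comult_p\<close> has already rewritten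
  \<open>\<Delta> p\<close>.\<close>

lemma sw2_comult_p [simp]:
  assumes "\<And>b. k_linear (\<lambda>a. F a b)" "\<And>a. k_linear (F a)"
  shows "sw2 (p \<otimes> 1 + 1 \<otimes> p - smul 2 (p \<otimes> p)) F = F p 1 + F 1 p - smul 2 (F p p)"
  using assms
  by (simp add: sw2_linear sw2_tens')

lemma sw2_one [simp]:
  assumes "\<And>b. k_linear (\<lambda>a. F a b)" "\<And>a. k_linear (F a)"
  shows "sw2 1 F = F (1 :: 'g \<Rightarrow>\<^sub>0 'k) (1 :: 'g \<Rightarrow>\<^sub>0 'k)"
  using sw2_tens'[of F 1 1, OF assms] by simp

subsection \<open>Bosonisation\<close>

lemma act_eq: "h \<triangleright> u = smul (\<epsilon> h) u"
proof -
  have "basis_vec g * u * basis_vec g = u" for g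
    by (subst mult.commute) (simp add: mult_single add_self flip: mult.assoc)
  then show ?thesis
    by (intro k_linear_eqI[where v = h and L = "\<lambda>h. h \<triangleright> u" and M = "\<lambda>h. smul (\<epsilon> h) u"])
      (simp_all add: act_def)
qed

text \<open>The legs of \<Delta>(X^3) multiply to \<epsilon>(X^3), so only the unit term of
  \<open>\<Phi>\<close> survives; the legs of \<open>\<Phi>inv\<close> multiply to 1 - 2p, the group
  element \<open>x\<close>, which \<open>\<alpha>\<close> cancels.\<close>

lemma circ_eq: "u \<odot> v = u * v"
  by (simp add: circ_def reass_inv_eq,
    simp add: basis_vec_x linear_normalize, (simp add: smul_numeral algebra_simps)?)

lemma bos_mult_eq: "bos_mult = (*)"
proof (intro ext)
  fix u v :: "'g \<times> 'g \<Rightarrow>\<^sub>0 'k"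
  have mult_basis: "bos_mult (basis_vec (a, b)) (basis_vec (c, d)) = basis_vec (a, b) * basis_vec (c, d)"
    for a b c d
    by (simp add: bos_mult_def reass_inv_eq act_eq circ_eq mult_single lin_form_mult)
  \<comment> \<open>For linearity the sums stay unexpanded, so that the closure rules match
    them.\<close>
  have right: "k_linear (bos_mult u)" for u
    by (simp add: bos_mult_def[abs_def] del: sw3_reass)
  have left: "k_linear (\<lambda>u. bos_mult u v)" for v
    by (simp add: bos_mult_def del: sw3_reass)
  have mult_basis_vec: "bos_mult (basis_vec (a, b)) v = basis_vec (a, b) * v" for a b
    by (rule k_linear_eqI[where v = v, OF right]) (auto simp: mult_basis)
  show "bos_mult u v = u * v"
    by (rule k_linear_eqI[where v = u, OF left]) (auto simp: mult_basis_vec)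
qed

section \<open>The twist and the elements \<open>p_R\<close> and \<open>q_R\<close>\<close>

lemma A_elt_eq:
  "A_elt = 1 - smul 2 (p \<otimes> p \<otimes> p \<otimes> 1 + p \<otimes> 1 \<otimes> p \<otimes> p + 1 \<otimes> p \<otimes> p \<otimes> p
    - smul 2 (p \<otimes> p \<otimes> p \<otimes> p))"
  \<comment> \<open>The cross term vanishes because (p \<otimes> p) \<Delta>(p) = 0.\<close>
  by (simp add: A_elt_def reass_inv_eq mult4_eq,
    simp add: basis_vec_x linear_normalize, (simp add: smul_numeral algebra_simps)?)

lemma sw4_one [simp]:
  assumes "\<And>b c d. k_linear (\<lambda>a. F a b c d)" "\<And>a c d. k_linear (\<lambda>b. F a b c d)"
    "\<And>a b d. k_linear (\<lambda>c. F a b c d)" "\<And>a b c. k_linear (F a b c)"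
  shows "sw4 1 F = F (1 :: 'g \<Rightarrow>\<^sub>0 'k) (1 :: 'g \<Rightarrow>\<^sub>0 'k) (1 :: 'g \<Rightarrow>\<^sub>0 'k) (1 :: 'g \<Rightarrow>\<^sub>0 'k)"
  using sw4_tens[of F 1 1 1 1, OF assms] by simp

text \<open>As p x = -p, each of the four non-unit tensors in \<open>A_elt\<close> yields p
  \<otimes> p; the total coefficient is -2 (1 + 1 + 1 - 2) = -2.\<close>

lemma gamma_eq: "\<gamma> = basis_vec (x, x) - smul 2 (p \<otimes> p)"
  by (simp add: gamma_elt_def A_elt_eq sw4_linear sw4_tens,
    simp add: basis_vec_x linear_normalize, (simp add: smul_numeral algebra_simps)?)

lemma f_eq: "f_elt = 1 - smul 2 (p \<otimes> p)"
proof -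
  \<comment> \<open>What follows is arithmetic with two commuting idempotents. In it \<gamma>
    \<Delta>(p) = -\<Delta>(p), so the twist is \<gamma> + 2 \<Delta>(p).\<close>
  define a b where "a = p \<otimes> (1 :: 'g \<Rightarrow>\<^sub>0 'k)" and "b = (1 :: 'g \<Rightarrow>\<^sub>0 'k) \<otimes> p"
  have ab: "p \<otimes> p = a * b" "a * a = a" "b * b = b"
    by (simp_all add: a_def b_def tens_times_tens)
  have xx: "basis_vec (x, x) = 1 - 2 * a - 2 * b + 4 * (a * b)"
    by (simp add: basis_vec_x linear_normalize ab(1) flip: basis_vec_tens a_def b_def)
      (simp add: smul_numeral)
  \<comment> \<open>By cocommutativity the outer factors are both \<Delta>(p) = a + b - 2ab.\<close>
  have "f_elt = \<gamma> - 2 * ((a + b - 2 * (a * b)) * \<gamma> * (a + b - 2 * (a * b)))"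
    by (simp add: f_elt_def reass_inv_eq mult2_eq, simp add: ab(1) flip: a_def b_def)
      (simp add: smul_numeral algebra_simps)
  then show ?thesis
    unfolding gamma_eq xx smul_numeral ab(1)
    by (simp add: algebra_simps ab(2,3) ab(2,3)[THEN idem_left])
qed

lemma f_inv_eq: "f_inv = 1 - smul 2 (p \<otimes> p)"
  unfolding f_inv_def mult2_eq f_eq
  by (simp, rule the_inverse_eqI,
    simp add: algebra_simps smul_numeral tens_times_tens tens_times_tens_left)

lemma p_R_eq: "p_R = 1 - smul 2 (p \<otimes> p)"
  by (simp add: p_R_def reass_inv_eq)

text \<open>The plus sign comes from x p = -p.\<close>

lemma q_R_eq: "q_R = 1 \<otimes> basis_vec x + smul 2 (p \<otimes> p)"
  by (simp add: q_R_def inv_id tens_minus_right)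

text \<open>With c = 2 it also evaluates sums over \<open>f_inv\<close> and \<open>p_R\<close>,
  which have the same shape as the R-matrices.\<close>

lemma sw2_R [simp]:
  assumes "\<And>b. k_linear (\<lambda>a. F a b)" "\<And>a. k_linear (F a)"
  shows "sw2 (1 - smul c (p \<otimes> p)) F = F 1 1 - smul c (F p p)"
  using assms
  by (simp add: sw2_linear sw2_tens')

lemma sw2_q_R [simp]:
  assumes "\<And>b. k_linear (\<lambda>a. F a b)" "\<And>a. k_linear (F a)"
  shows "sw2 q_R F = F 1 (basis_vec x) + smul 2 (F p p)"
  using assms
  by (simp add: q_R_eq sw2_linear sw2_tens')

section \<open>The braided structure and the bosonisation\<close>

lemma braided_comult_eq: "braided_comult (1 - smul c (p \<otimes> p)) b = \<Delta> b"
proof -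
  \<comment> \<open>The action absorbs x^3 and R^1, leaving unit terms. The y-copy gives 1 - 2 p
    \<otimes> p, which \<open>f_inv\<close> cancels, and the X-copy gives 1 because (p \<otimes> p)
    \<Delta>(p) = 0.\<close>
  have "braided_comult (1 - smul c (p \<otimes> p)) (basis_vec g) = basis_vec (g, g)" for g
    by (simp add: braided_comult_def f_inv_eq reass_inv_eq act_eq lin_form_mult
        flip: basis_vec_tens,
      simp add: basis_vec_x linear_normalize, (simp add: smul_numeral algebra_simps)?)
  moreover have "k_linear (braided_comult (1 - smul c (p \<otimes> p)))"
    by (simp add: braided_comult_def[abs_def] del: sw3_reass sw2_R)
  ultimately show ?thesis
    by (intro k_linear_eqI[where v = b and M = "\<Delta>"]) auto
qed

text \<open>\<open>\<Phi>\<close>, \<open>R\<close> and \<open>p_R\<close> each have a leg inside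
  the action and reduce to their unit terms; the legs of \<open>q_R\<close> multiply to x + 2p =
  1.\<close>

lemma braided_antipode_eq: "braided_antipode (1 - smul c (p \<otimes> p)) b = b"
  by (simp add: braided_antipode_def p_R_eq act_eq lin_form_mult,
    simp add: basis_vec_x linear_normalize, (simp add: smul_numeral algebra_simps)?)

text \<open>Every copy of \<open>\<Phi>\<close>, of its inverse and of the R-matrix has a leg inside
  an action, so a counit reduces it to its unit term.\<close>

lemma bos_comult_eq:
  "bos_comult (1 - smul c (p \<otimes> p)) u = lin_ext (\<lambda>g. basis_vec (g, g)) u"
proof -
  have "bos_comult (1 - smul c (p \<otimes> p)) (basis_vec (g, h)) = basis_vec ((g, h), (g, h))" for g h
    by (simp add: bos_comult_def braided_comult_eq reass_inv_eq act_eq lin_form_mult)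
  moreover have "k_linear (bos_comult (1 - smul c (p \<otimes> p)))"
    by (simp add: bos_comult_def[abs_def] del: sw3_reass sw2_R)
  ultimately show ?thesis
    by (intro k_linear_eqI[where v = u and L = "bos_comult (1 - smul c (p \<otimes> p))"]) auto
qed

text \<open>The counit removes \<open>\<Phi>\<close>, the R-matrix and the second leg of
  \<Delta>(x^1). What remains of \<open>\<Phi>inv\<close> is x^1 x^2 x^3 = 1 - 2p, inverse to
  \<open>\<alpha>\<close>.\<close>

lemma bos_antipode_eq: "bos_antipode (1 - smul c (p \<otimes> p)) u = u"
proof -
  have "bos_antipode (1 - smul c (p \<otimes> p)) (basis_vec (g, h)) = basis_vec (g, h)" for g h
    by (simp add: bos_antipode_def bos_mult_eq braided_antipode_eq reass_inv_eq act_eq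
        lin_form_mult tens_times_tens)
      (simp add: basis_vec_x linear_normalize flip: basis_vec_tens,
       simp add: smul_numeral)
  moreover have "k_linear (bos_antipode (1 - smul c (p \<otimes> p)))"
    by (simp add: bos_antipode_def[abs_def] del: sw3_reass sw2_R)
  ultimately show ?thesis
    by (intro k_linear_eqI[where v = u and M = "\<lambda>u. u"]) auto
qed

text \<open>The result is independent of \<open>c\<close>, so the values 1 + i and 1 - i give the
  same quasi-Hopf algebra. The marked element is \<open>x\<close> in the second factor, since the
  reassociator and \<open>\<alpha>\<close> carry \<beta> = 1 in the first.\<close>

lemma bos_eq: "bos (1 - smul c (p \<otimes> p)) = group_quasi_hopf (0, x)"
proof -
  have "(1 :: 'g \<Rightarrow>\<^sub>0 'k) \<otimes> p = p_minus (0, x)"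
    by (simp add: p_def p_minus_def tens_linear flip: single_one) (simp add: zero_prod_def)
  then have "sw3 \<Phi> (\<lambda>X1 X2 X3. (\<beta> \<otimes> X1) \<otimes> (\<beta> \<otimes> X2) \<otimes> (\<beta> \<otimes> X3)) =
      qreass (group_quasi_hopf (0, x))"
    by (simp add: group_quasi_hopf_def)
  moreover have "(1 :: 'g \<Rightarrow>\<^sub>0 'k) \<otimes> basis_vec x = (basis_vec (0, x) :: _ \<Rightarrow>\<^sub>0 'k)"
    by (simp flip: single_one)
  ultimately show ?thesis
    by (simp add: bos_def group_quasi_hopf_def bos_mult_eq bos_comult_eq[abs_def]
        bos_antipode_eq[abs_def] id_def case_prod_unfold)
qed

subsection \<open>Quasi-Hopf axioms\<close>

text \<open>Once the sums are expanded, both sides are polynomials in the four commuting idempotents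
  having \<open>p\<close> in a single leg.\<close>

lemma pentagon:
  "(1 \<otimes> \<Phi>)
      * sw3 \<Phi> (\<lambda>X1 X2 X3. sw2 (\<Delta> X2) (\<lambda>X21 X22. X1 \<otimes> X21 \<otimes> X22 \<otimes> X3))
      * sw3 \<Phi> (\<lambda>X1 X2 X3. X1 \<otimes> X2 \<otimes> X3 \<otimes> (1 :: 'g \<Rightarrow>\<^sub>0 'k))
    = sw3 \<Phi> (\<lambda>X1 X2 X3. X1 \<otimes> X2 \<otimes> \<Delta> X3)
      * sw3 \<Phi> (\<lambda>X1 X2 X3. sw2 (\<Delta> X1) (\<lambda>X11 X12. X11 \<otimes> X12 \<otimes> X2 \<otimes> X3))"
  by (simp, simp add: reass_eq linear_normalize)

lemma comult_coassoc:
  "sw2 (\<Delta> h) (\<lambda>h1 h2. sw2 (\<Delta> h1) (\<lambda>h11 h12. h11 \<otimes> h12 \<otimes> h2)) =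
    sw2 (\<Delta> h) (\<lambda>h1 h2. h1 \<otimes> \<Delta> h2)"
  by (rule k_linear_eqI[where v = h and M = "\<lambda>h. sw2 (\<Delta> h) (\<lambda>h1 h2. h1 \<otimes> \<Delta> h2)"]) simp_all

lemma quasi_bialgebra: "quasi_bialgebra"
proof -
  \<comment> \<open>Conjugation by \<open>\<Phi>\<close> is trivial in a commutative ring, so
    quasi-coassociativity reduces to \<open>comult_coassoc\<close>.\<close>
  have "\<Phi> * t * \<Phi> = t" for t
    using reass_reass by (metis mult.assoc mult.commute mult_1_right)
  moreover have "sw2 (\<Delta> h) (\<lambda>h1 h2. smul (\<epsilon> h2) h1) = h" for h
    by (rule k_linear_eqI[where v = h and M = "\<lambda>h. h"]) simp_all
  moreover have "sw2 (\<Delta> h) (\<lambda>h1 h2. smul (\<epsilon> h1) h2) = h" for h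
    by (rule k_linear_eqI[where v = h and M = "\<lambda>h. h"]) simp_all
  moreover have "is_inverse (*) 1 \<Phi> \<Phi>"
    by (simp add: is_inverse_def reass_reass)
  ultimately show ?thesis
    using comult_coassoc pentagon
    unfolding quasi_bialgebra_def algebra_axioms_def k_bilinear_def
    by (auto simp: mult2_eq mult3_eq mult4_eq reass_inv_eq comult_mult lin_form_mult mult.assoc
        k_linear_form_iff lin_form_add lin_form_smul k_linear_lin_ext)
qed

lemma quasi_hopf_algebra: "quasi_hopf_algebra"
proof -
  \<comment> \<open>As the antipode is the identity, both antipode axioms say that the adjoint
    action on \<open>\<alpha>\<close> and on \<open>\<beta>\<close> is trivial.\<close>
  have "sw2 (\<Delta> h) (\<lambda>h1 h2. h1 * u * h2) = smul (\<epsilon> h) u" for h u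
    using act_eq[of h u] by (simp add: act_def)
  from this this[of _ 1] have "sw2 (\<Delta> h) (\<lambda>h1 h2. S h1 * \<alpha> * h2) = smul (\<epsilon> h) \<alpha>"
    "sw2 (\<Delta> h) (\<lambda>h1 h2. h1 * \<beta> * S h2) = smul (\<epsilon> h) \<beta>" for h
    by simp_all
  \<comment> \<open>Both sums equal (1 - 2p) x = x x = 1.\<close>
  moreover have "sw3 \<Phi> (\<lambda>X1 X2 X3. X1 * \<beta> * S X2 * \<alpha> * X3) = 1"
    "sw3 \<Phi> (\<lambda>x1 x2 x3. S x1 * \<alpha> * x2 * \<beta> * S x3) = 1"
    by (simp_all add: mult.assoc) (simp_all add: basis_vec_x)
  ultimately show ?thesis
    using quasi_bialgebra
    by (simp add: quasi_hopf_algebra_def reass_inv_eq k_linear_iff mult.commute)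
qed

lemma involutory: "involutory"
  using quasi_hopf_algebra unfolding involutory_def by (simp add: mult.commute[of _ "basis_vec x"])

end

section \<open>The bosonisations of \<open>H(2)\<^sub>\<plusminus>\<close>\<close>

text \<open>\<open>group_quasi_hopf\<close> is built from the group and the marked element alone, so
  a group isomorphism transports all of it.\<close>

lemma group_quasi_hopf_iso:
  fixes h :: "'g::comm_monoid_add \<Rightarrow> 'h::comm_monoid_add"
  assumes "bij h" "\<And>a b. h (a + b) = h a + h b" "h 0 = 0"
  shows "quasi_hopf_iso (lin_ext (\<lambda>g. basis_vec (h g)))
    (group_quasi_hopf x :: ('g, 'k::field) quasi_hopf) (group_quasi_hopf (h x))"
proof -
  let ?\<phi> = "lin_ext (\<lambda>g. basis_vec (h g)) :: ('g \<Rightarrow>\<^sub>0 'k) \<Rightarrow> _"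
  let ?\<psi> = "lin_ext (\<lambda>g. basis_vec (inv h g)) :: ('h \<Rightarrow>\<^sub>0 'k) \<Rightarrow> _"
  have "?\<psi> (?\<phi> v) = v" for v
    using assms(1) by (intro k_linear_eqI[where v = v and M = "\<lambda>v. v"] k_linear_intros)
      (simp add: bij_is_inj)
  moreover have "?\<phi> (?\<psi> v) = v" for v
    using assms(1) by (intro k_linear_eqI[where v = v and M = "\<lambda>v. v"] k_linear_intros)
      (simp add: bij_is_surj surj_f_inv_f)
  ultimately have bij: "bij ?\<phi>"
    by (intro bijI') metis+
  have one: "?\<phi> 1 = 1"
    by (simp add: assms(3) flip: single_one)
  have p: "?\<phi> (p_minus x) = p_minus (h x)"
    by (simp add: p_minus_def lin_ext_smul k_linear_imp_diff[OF k_linear_lin_ext] one)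
  have "?\<phi> (basis_vec a * v) = basis_vec (h a) * ?\<phi> v" for a v
    by (rule k_linear_eqI[where v = v and M = "\<lambda>v. basis_vec (h a) * ?\<phi> v"])
      (auto simp: mult_single assms(2) intro!: k_linear_intros)
  then have "?\<phi> (u * v) = ?\<phi> u * ?\<phi> v" for u v
    by (intro k_linear_eqI[where v = u and L = "\<lambda>u. ?\<phi> (u * v)" and M = "\<lambda>u. ?\<phi> u * ?\<phi> v"])
      (auto intro!: k_linear_intros)
  moreover have "lin_ext (\<lambda>g. basis_vec (g, g)) (?\<phi> u) =
      sw2 (lin_ext (\<lambda>g. basis_vec (g, g)) u) (\<lambda>a b. ?\<phi> a \<otimes> ?\<phi> b)" for u
    by (rule k_linear_eqI[where v = u and L = "\<lambda>u. lin_ext (\<lambda>g. basis_vec (g, g)) (?\<phi> u)"])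
      (auto intro!: k_linear_intros)
  moreover have "lin_form (\<lambda>g. 1) (?\<phi> u) = lin_form (\<lambda>g. 1) u" for u
    by (rule k_linear_form_eqI[where v = u and M = "lin_form (\<lambda>g. 1)"])
      (simp_all add: k_linear_form_iff lin_ext_add lin_ext_smul lin_form_add lin_form_smul)
  moreover have "sw3 (qreass (group_quasi_hopf x)) (\<lambda>a b c. ?\<phi> a \<otimes> ?\<phi> b \<otimes> ?\<phi> c) =
      qreass (group_quasi_hopf (h x))"
  proof -
    let ?F = "\<lambda>a b c. ?\<phi> a \<otimes> ?\<phi> b \<otimes> ?\<phi> c"
    have "sw3 (a \<otimes> b \<otimes> c) ?F = ?F a b c" for a b c
      by (rule sw3_tens) (intro k_linear_intros)+
    \<comment> \<open>The unit must stay a pure tensor here for the evaluation just proved to match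
      it.\<close>
    then show ?thesis
      by (simp add: group_quasi_hopf_def sw3_linear one p del: one_tens_one)
  qed
  ultimately show ?thesis
    using bij by (simp add: quasi_hopf_iso_def k_linear_lin_ext one)
qed

theorem proposition2p8:
  fixes i :: "'k::field" and x :: "bit \<times> bit"
  assumes "CHAR('k) \<noteq> 2"
    and "primitive_root_of_unity 4 i"
    and "x \<in> {(1, 0), (0, 1)}"
  shows "bos H2 (R_plus i) = bos H2 (R_minus i)
    \<and> (\<exists>\<phi>. quasi_hopf_iso \<phi> (bos H2 (R_plus i)) (kC2C2 x))
    \<and> (\<exists>\<phi>. quasi_hopf_iso \<phi> (bos H2 (R_minus i)) (kC2C2 x))
    \<and> quasi_hopf_algebra (kC2C2 x :: (bit \<times> bit, 'k) quasi_hopf)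
    \<and> involutory (bos H2 (R_plus i))
    \<and> involutory (bos H2 (R_minus i))"
proof -
  \<comment> \<open>If 2 = 0 then the characteristic divides 2, and 1 is impossible in a
    field.\<close>
  have two: "(2::'k) \<noteq> 0"
  proof
    assume "(2::'k) = 0"
    then have "CHAR('k) dvd 2" using of_nat_eq_0_iff_char_dvd[where 'a = 'k, of 2] by simp
    moreover from this have "CHAR('k) \<le> 2"
      by (rule dvd_imp_le) simp
    then have "CHAR('k) = 0 \<or> CHAR('k) = 1 \<or> CHAR('k) = 2"
      by linarith
    ultimately show False
      using assms(1) of_nat_CHAR[where 'a = 'k] by auto
  qed
  have bit_add_self: "b + b = 0" for b :: bit
    by (cases b) simp_all
  interpret H2: elementary_2_group "H2 :: (bit, 'k) quasi_hopf" 1 "p_minus 1"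
    using two by unfold_locales (simp_all add: H2_def bit_add_self)
  interpret kC2C2: elementary_2_group "kC2C2 y :: (bit \<times> bit, 'k) quasi_hopf" y "p_minus y" for y
    using two by unfold_locales (auto simp: bit_add_self zero_prod_def)
  have bos: "bos H2 (R_plus i) = kC2C2 (0, 1)" "bos H2 (R_minus i) = kC2C2 (0, 1)"
    using H2.bos_eq by (simp_all add: R_plus_def R_minus_def)
  \<comment> \<open>The bosonisation marks (0, 1), so an automorphism taking it to \<open>x\<close>
    is wanted: the identity or the swap of the factors.\<close>
  obtain h :: "bit \<times> bit \<Rightarrow> bit \<times> bit" where h:
    "bij h" "\<And>a b. h (a + b) = h a + h b" "h 0 = 0" "h (0, 1) = x"
  proof (cases "x = (0, 1)")
    case True
    then show ?thesis using that[of id] by simp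
  next
    case False
    then show ?thesis using assms(3) that[of prod.swap] by (auto simp: zero_prod_def)
  qed
  have "\<exists>\<phi>. quasi_hopf_iso \<phi> (kC2C2 (0, 1) :: (_, 'k) quasi_hopf) (kC2C2 x)"
    using group_quasi_hopf_iso[OF h(1-3), of "(0, 1)"] h(4) by metis
  then show ?thesis
    using kC2C2.quasi_hopf_algebra kC2C2.involutory by (simp add: bos)
qed

end
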